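(* Let $\Gamma$ be a distance-regular graph with valency $k\geq 3$, diameter $D\geq 2$, $a_1\neq 0$ and distinct eigenvalues $\theta_0>\theta_1>\cdots>\theta_D=-\frac{k}{a_1+1}$. If $c_2=(a_1+1)^2+1$ and $\Gamma$ contains an induced subgraph isomorphic to a generalized quadrangle $GQ(a_1+1,c_2-1)$, then $\theta_1=\frac{k-(a_1+1)(a_1+2)}{(a_1+1)^2}$ and $E_D$ is a light tail with associated minimal idempotent $E_1$.
   Context: A connected graph $\Gamma$ of diameter $D$ is distance-regular if there are integers $b_i,c_i$ ($0\le i\le D$) such that for any vertices $x,y$ at distance $i$, $y$ has exactly $c_i$ neighbours at distance $i-1$ from $x$ and $b_i$ neighbours at distance $i+1$ from $x$; $k=b_0$ and $a_i=k-b_i-c_i$. The eigenvalues are those of the adjacency matrix; $E_i$ denotes the orthogonal projection onto the $\theta_i$-eigenspace, with $E_0=\frac1n J$ ($n$ the number of vertices). A minimal idempotent $E$ is a light tail if $E\circ E=aE_0+bF$ (entrywise product) for some minimal idempotent $F\neq E_0$ and nonzero reals $a,b$; $F$ is the associated minimal idempotent. A generalized quadrangle $GQ(s,t)$ is a $K_{1,1,2}$-free distance-regular graph of diameter $2$ with intersection array $\{(t+1)s,ts;1,t+1\}$. *)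

theory Defs
  imports "HOL-Analysis.Analysis"
begin

definition simple_graph :: "'a set \<Rightarrow> ('a \<Rightarrow> 'a \<Rightarrow> bool) \<Rightarrow> bool" where
  "simple_graph V E \<longleftrightarrow> finite V \<and> V \<noteq> {} \<and>
     (\<forall>x\<in>V. \<forall>y\<in>V. E x y \<longleftrightarrow> E y x) \<and> (\<forall>x\<in>V. \<not> E x x)"

fun walk :: "'a set \<Rightarrow> ('a \<Rightarrow> 'a \<Rightarrow> bool) \<Rightarrow> nat \<Rightarrow> 'a \<Rightarrow> 'a \<Rightarrow> bool" where
  "walk V E 0 x y \<longleftrightarrow> x \<in> V \<and> x = y"
| "walk V E (Suc n) x y \<longleftrightarrow> x \<in> V \<and> (\<exists>z\<in>V. E x z \<and> walk V E n z y)"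

definition gdist :: "'a set \<Rightarrow> ('a \<Rightarrow> 'a \<Rightarrow> bool) \<Rightarrow> 'a \<Rightarrow> 'a \<Rightarrow> nat" where
  "gdist V E x y = (LEAST n. walk V E n x y)"

definition connected_graph :: "'a set \<Rightarrow> ('a \<Rightarrow> 'a \<Rightarrow> bool) \<Rightarrow> bool" where
  "connected_graph V E \<longleftrightarrow> (\<forall>x\<in>V. \<forall>y\<in>V. \<exists>n. walk V E n x y)"

definition diameter :: "'a set \<Rightarrow> ('a \<Rightarrow> 'a \<Rightarrow> bool) \<Rightarrow> nat" where
  "diameter V E = Max {gdist V E x y | x y. x \<in> V \<and> y \<in> V}"

definition distance_regular ::
  "'a set \<Rightarrow> ('a \<Rightarrow> 'a \<Rightarrow> bool) \<Rightarrow> nat \<Rightarrow> (nat \<Rightarrow> nat) \<Rightarrow> (nat \<Rightarrow> nat) \<Rightarrow> bool" where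
  "distance_regular V E D b c \<longleftrightarrow>
     simple_graph V E \<and> connected_graph V E \<and> diameter V E = D \<and>
     (\<forall>i\<le>D. \<forall>x\<in>V. \<forall>y\<in>V. gdist V E x y = i \<longrightarrow>
        card {z\<in>V. E y z \<and> i \<ge> 1 \<and> gdist V E x z = i - 1} = c i \<and>
        card {z\<in>V. E y z \<and> gdist V E x z = i + 1} = b i)"

definition dr_a :: "(nat \<Rightarrow> nat) \<Rightarrow> (nat \<Rightarrow> nat) \<Rightarrow> nat \<Rightarrow> int" where
  "dr_a b c i = int (b 0) - int (b i) - int (c i)"

definition K112_free :: "'a set \<Rightarrow> ('a \<Rightarrow> 'a \<Rightarrow> bool) \<Rightarrow> bool" where
  "K112_free V E \<longleftrightarrow> \<not> (\<exists>x\<in>V. \<exists>y\<in>V. \<exists>u\<in>V. \<exists>v\<in>V. u \<noteq> v \<and>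
       E x y \<and> E x u \<and> E x v \<and> E y u \<and> E y v \<and> \<not> E u v)"

definition is_GQ :: "'a set \<Rightarrow> ('a \<Rightarrow> 'a \<Rightarrow> bool) \<Rightarrow> nat \<Rightarrow> nat \<Rightarrow> bool" where
  "is_GQ V E s t \<longleftrightarrow> K112_free V E \<and>
     (\<exists>b c. distance_regular V E 2 b c \<and>
        b 0 = (t + 1) * s \<and> b 1 = t * s \<and> c 1 = 1 \<and> c 2 = t + 1)"

text \<open>The induced subgraph on S is isomorphic to a GQ(s,t).  Being a GQ(s,t) is an
  isomorphism-invariant property, so we require the induced subgraph itself to be one.\<close>
definition has_induced_GQ :: "('a \<Rightarrow> 'a \<Rightarrow> bool) \<Rightarrow> nat \<Rightarrow> nat \<Rightarrow> bool" where
  "has_induced_GQ E s t \<longleftrightarrow> (\<exists>S. is_GQ S E s t)"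

definition adj_matrix :: "('a::finite \<Rightarrow> 'a \<Rightarrow> bool) \<Rightarrow> real^'a^'a" where
  "adj_matrix E = (\<chi> i j. if E i j then 1 else 0)"

definition is_eigenvalue :: "real^'a^'a \<Rightarrow> real \<Rightarrow> bool" where
  "is_eigenvalue A \<theta> \<longleftrightarrow> (\<exists>x. x \<noteq> 0 \<and> A *v x = \<theta> *\<^sub>R x)"

definition eigenspace :: "real^'a^'a \<Rightarrow> real \<Rightarrow> (real^'a) set" where
  "eigenspace A \<theta> = {x. A *v x = \<theta> *\<^sub>R x}"

definition eigenproj :: "real^'a^'a \<Rightarrow> real \<Rightarrow> real^'a^'a" where
  "eigenproj A \<theta> = (THE P. transpose P = P \<and> P ** P = P \<and> range (\<lambda>x. P *v x) = eigenspace A \<theta>)"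

definition minimal_idempotent :: "real^'a^'a \<Rightarrow> real^'a^'a \<Rightarrow> bool" where
  "minimal_idempotent A F \<longleftrightarrow> (\<exists>\<theta>. is_eigenvalue A \<theta> \<and> F = eigenproj A \<theta>)"

definition hadamard :: "real^'a^'a \<Rightarrow> real^'a^'a \<Rightarrow> real^'a^'a" where
  "hadamard P Q = (\<chi> i j. P $ i $ j * Q $ i $ j)"

text \<open>E is a light tail with associated minimal idempotent F (E0 = the principal idempotent J/n).\<close>
definition light_tail_with :: "real^'a^'a \<Rightarrow> real^'a^'a \<Rightarrow> real^'a^'a \<Rightarrow> real^'a^'a \<Rightarrow> bool" where
  "light_tail_with A E0 E F \<longleftrightarrow> minimal_idempotent A E \<and> minimal_idempotent A F \<and> F \<noteq> E0 \<and>
     (\<exists>a b. a \<noteq> 0 \<and> b \<noteq> 0 \<and> hadamard E E = a *\<^sub>R E0 + b *\<^sub>R F)"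

end

theory Submission
  imports Defs
begin

text \<open>Put \<open>s = a\<^sub>1 + 1\<close>. The columns of \<open>E\<^sub>D\<close>, scaled to unit vectors \<open>w x\<close>, have inner products
  \<open>u (d x y)\<close> with \<open>u 1 = -1/s\<close> and \<open>u 2 = 1/s\<^sup>2\<close>. For \<open>x\<close>, \<open>y\<close> at distance 2 the hypothesis
  \<open>c\<^sub>2 = s\<^sup>2 + 1\<close> forces the common neighbours \<open>z\<close> to be pairwise nonadjacent with
  \<open>\<Sum> w z = -s (w x + w y)\<close>. So every edge lies in a unique maximal clique, whose vectors sum to 0,
  and the vectors of a vertex \<open>y\<close> and its neighbours span everything. The map
  \<open>v \<mapsto> \<Sum> (w z \<bullet> v) w z\<close>, summed over the neighbours \<open>z\<close> of \<open>y\<close>, can therefore be computed: it is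
  \<open>v \<mapsto> \<rho> (w y \<bullet> v) w y + \<beta> v\<close>. Hence \<open>u\<^sup>2\<close> is a constant plus a multiple of the cosine sequence of
  \<open>\<rho>\<close>, which is the light tail property. Finally, testing the Gram matrix of another eigenvalue \<open>\<eta>\<close>
  on the generalized quadrangle yields \<open>(\<eta> - k) (\<eta> - \<rho>) \<ge> 0\<close>, so no eigenvalue lies strictly
  between \<open>\<rho>\<close> and \<open>k\<close>.\<close>

section \<open>Distances in a distance-regular graph\<close>

lemma walk_in_carrier: "walk V E n x y \<Longrightarrow> x \<in> V \<and> y \<in> V"
  by (induction n arbitrary: x) auto

lemma walk_append: "walk V E m x y \<Longrightarrow> walk V E n y z \<Longrightarrow> walk V E (m + n) x z"
  by (induction m arbitrary: x) auto

lemma walk_snoc: "walk V E n x y \<Longrightarrow> E y z \<Longrightarrow> z \<in> V \<Longrightarrow> walk V E (Suc n) x z"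
  using walk_append[of V E n x y 1 z] walk_in_carrier[of V E n x y] by simp

lemma walk_sym:
  assumes "\<And>x y. x \<in> V \<Longrightarrow> y \<in> V \<Longrightarrow> E x y \<longleftrightarrow> E y x"
  shows "walk V E n x y \<Longrightarrow> walk V E n y x"
proof (induction n arbitrary: x)
  case (Suc n)
  then obtain z where "x \<in> V" "z \<in> V" "E x z" "walk V E n z y"
    by auto
  with Suc.IH[of z] assms[of x z] walk_snoc[of V E n y z x] show ?case
    by auto
qed simp

locale drg =
  fixes V :: "'a set" and E :: "'a \<Rightarrow> 'a \<Rightarrow> bool" and D :: nat and b c :: "nat \<Rightarrow> nat"
  assumes dr: "distance_regular V E D b c"
begin

abbreviation d :: "'a \<Rightarrow> 'a \<Rightarrow> nat" where
  "d \<equiv> gdist V E"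

abbreviation a :: "nat \<Rightarrow> real" where
  "a i \<equiv> real (b 0) - real (b i) - real (c i)"

lemma finite_V: "finite V"
  and V_nonempty: "V \<noteq> {}"
  and E_sym: "x \<in> V \<Longrightarrow> y \<in> V \<Longrightarrow> E x y \<longleftrightarrow> E y x"
  and E_irrefl: "x \<in> V \<Longrightarrow> \<not> E x x"
  using dr unfolding distance_regular_def simple_graph_def by auto

lemma walk_d: "x \<in> V \<Longrightarrow> y \<in> V \<Longrightarrow> walk V E (d x y) x y"
  using dr unfolding distance_regular_def connected_graph_def gdist_def by (metis LeastI_ex)

lemma d_le: "walk V E n x y \<Longrightarrow> d x y \<le> n"
  unfolding gdist_def by (rule Least_le)

lemma d_sym: "x \<in> V \<Longrightarrow> y \<in> V \<Longrightarrow> d x y = d y x"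
  using d_le[OF walk_sym[OF E_sym walk_d[of x y]]] d_le[OF walk_sym[OF E_sym walk_d[of y x]]]
  by simp

lemma d_self [simp]: "x \<in> V \<Longrightarrow> d x x = 0"
  using d_le[of 0 x x] by simp

lemma d_eq_0: "x \<in> V \<Longrightarrow> y \<in> V \<Longrightarrow> d x y = 0 \<longleftrightarrow> x = y"
  using walk_d[of x y] by auto

lemma d_triangle: "x \<in> V \<Longrightarrow> y \<in> V \<Longrightarrow> z \<in> V \<Longrightarrow> d x z \<le> d x y + d y z"
  by (rule d_le[OF walk_append[OF walk_d walk_d]])

lemma d_eq_1: assumes "x \<in> V" "y \<in> V" shows "d x y = 1 \<longleftrightarrow> E x y"
proof
  assume "d x y = 1"
  with walk_d[OF assms] show "E x y" by auto
next
  assume "E x y"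
  with assms have "walk V E 1 x y" by auto
  then have "d x y \<le> 1" by (rule d_le)
  moreover have "d x y \<noteq> 0" using \<open>E x y\<close> assms E_irrefl d_eq_0 by auto
  ultimately show "d x y = 1" by simp
qed

lemma d_nbr:
  assumes "x \<in> V" "y \<in> V" "z \<in> V" "E y z"
  shows "d x z \<le> d x y + 1" "d x y \<le> d x z + 1"
  using d_triangle[of x y z] d_triangle[of x z y] d_eq_1[of y z] d_sym[of y z] assms by auto

lemma d_eq_2:
  assumes "x \<in> V" "y \<in> V" "z \<in> V" "E x z" "E z y" "x \<noteq> y" "\<not> E x y"
  shows "d x y = 2"
  using d_nbr(1)[of x z y] d_eq_1[of x z] d_eq_1[of x y] d_eq_0[of x y] assms by linarith

lemma d_pred:
  assumes "x \<in> V" "y \<in> V" "d x y = Suc i"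
  shows "\<exists>z\<in>V. E y z \<and> d x z = i"
proof -
  have "walk V E (Suc i) y x"
    using walk_d[of y x] d_sym[of x y] assms by simp
  then obtain z where z: "z \<in> V" "E y z" "walk V E i z x"
    by auto
  have "d x z \<le> i" using d_le[OF z(3)] d_sym[of x z] z assms by simp
  moreover have "d x z \<ge> i" using d_nbr(2)[of x y z] z assms by simp
  ultimately show ?thesis using z by (auto intro!: bexI[of _ z])
qed

lemma diameter_set:
  "D = Max {d x y | x y. x \<in> V \<and> y \<in> V}" "finite {d x y | x y. x \<in> V \<and> y \<in> V}"
proof -
  have "{d x y | x y. x \<in> V \<and> y \<in> V} = (\<lambda>(x, y). d x y) ` (V \<times> V)" by auto
  then show "finite {d x y | x y. x \<in> V \<and> y \<in> V}" using finite_V by simp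
qed (use dr in \<open>simp add: distance_regular_def diameter_def\<close>)

lemma d_le_D: "x \<in> V \<Longrightarrow> y \<in> V \<Longrightarrow> d x y \<le> D"
  unfolding diameter_set(1) using diameter_set(2) by (intro Max_ge) auto

lemma ex_d_eq: "i \<le> D \<Longrightarrow> \<exists>x\<in>V. \<exists>y\<in>V. d x y = i"
proof (induction i rule: inc_induct)
  case base
  have "D \<in> {d x y | x y. x \<in> V \<and> y \<in> V}"
    unfolding diameter_set(1) using diameter_set(2) V_nonempty by (intro Max_in) auto
  then show ?case by auto
next
  case (step i)
  then show ?case using d_pred by blast
qed

section \<open>Neighbour counts and the intersection numbers\<close>

lemma card_dr:
  assumes "x \<in> V" "y \<in> V" "d x y = i"
  shows "card {z\<in>V. E y z \<and> i \<ge> 1 \<and> d x z = i - 1} = c i"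
    and "card {z\<in>V. E y z \<and> d x z = i + 1} = b i"
proof -
  have "\<forall>i\<le>D. \<forall>x\<in>V. \<forall>y\<in>V. d x y = i \<longrightarrow>
        card {z\<in>V. E y z \<and> i \<ge> 1 \<and> d x z = i - 1} = c i \<and>
        card {z\<in>V. E y z \<and> d x z = i + 1} = b i"
    using dr unfolding distance_regular_def by (elim conjE)
  from this[rule_format, of i x y] assms d_le_D[of x y]
  show "card {z\<in>V. E y z \<and> i \<ge> 1 \<and> d x z = i - 1} = c i"
    and "card {z\<in>V. E y z \<and> d x z = i + 1} = b i" by simp_all
qed

lemma card_c:
  assumes "x \<in> V" "y \<in> V" "d x y = Suc i"
  shows "card {z\<in>V. E y z \<and> d x z = i} = c (Suc i)"
  using card_dr(1)[OF assms] by simp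

lemma card_b:
  assumes "x \<in> V" "y \<in> V" "d x y = i"
  shows "card {z\<in>V. E y z \<and> d x z = Suc i} = b i"
  using card_dr(2)[OF assms] by simp

lemma c_0: "c 0 = 0"
proof -
  obtain x where x: "x \<in> V" using V_nonempty by auto
  then show ?thesis using card_dr(1)[OF x x d_self] by simp
qed

lemma degree: "x \<in> V \<Longrightarrow> card {z\<in>V. E x z} = b 0"
proof -
  assume x: "x \<in> V"
  have "{z\<in>V. E x z} = {z\<in>V. E x z \<and> d x z = Suc 0}"
    using x d_eq_1[of x] by auto
  then show ?thesis using card_b[of x x 0] x by simp
qed

lemma b_pos: assumes "i < D" shows "b i > 0"
proof -
  obtain x y where xy: "x \<in> V" "y \<in> V" "d x y = Suc i"
    using ex_d_eq[of "Suc i"] assms by auto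
  then obtain z where z: "z \<in> V" "E y z" "d x z = i" using d_pred by blast
  have "{y\<in>V. E z y \<and> d x y = Suc i} \<noteq> {}" using xy z E_sym by auto
  then have "card {y\<in>V. E z y \<and> d x y = Suc i} > 0" using finite_V by (simp add: card_gt_0_iff)
  then show ?thesis using card_b[of x z i] xy z by simp
qed

lemma c_pos: assumes "0 < i" "i \<le> D" shows "c i > 0"
proof -
  obtain j where j: "i = Suc j" using assms by (cases i) auto
  obtain x y where xy: "x \<in> V" "y \<in> V" "d x y = Suc j"
    using ex_d_eq[of i] assms j by auto
  then obtain z where "z \<in> V" "E y z" "d x z = j" using d_pred by blast
  then have "{z\<in>V. E y z \<and> d x z = j} \<noteq> {}" by auto
  then have "card {z\<in>V. E y z \<and> d x z = j} > 0" using finite_V by (simp add: card_gt_0_iff)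
  then show ?thesis using card_c[OF xy] j by simp
qed

lemma b_D: "b D = 0"
proof -
  obtain x y where xy: "x \<in> V" "y \<in> V" "d x y = D"
    using ex_d_eq[of D] by auto
  have "{z\<in>V. E y z \<and> d x z = Suc D} = {}" using d_le_D[of x] xy by fastforce
  then show ?thesis using card_b[OF xy] by (metis card.empty)
qed

lemma c_1: assumes "D \<ge> 1" shows "c 1 = 1"
proof -
  obtain x y where xy: "x \<in> V" "y \<in> V" "d x y = Suc 0"
    using ex_d_eq[of 1] assms by auto
  then have "{z\<in>V. E y z \<and> d x z = 0} = {x}"
    using d_eq_0[of x] d_eq_1[of x y] E_sym[of x y] by auto
  then show ?thesis using card_c[OF xy] by simp
qed

text \<open>The neighbours of \<open>y\<close> split by their distance from \<open>x\<close> into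
  classes of sizes \<open>c i\<close>, \<open>a i\<close> and \<open>b i\<close>. At
  \<open>i = 0\<close> the truncated \<open>i - 1\<close> does no harm, because
  \<open>c 0 = 0\<close>.\<close>

lemma radial_sum:
  fixes h :: "nat \<Rightarrow> real"
  assumes x: "x \<in> V" and y: "y \<in> V" and i: "d x y = i"
  shows "(\<Sum>z\<in>{z\<in>V. E y z}. h (d x z)) = c i * h (i - 1) + a i * h i + b i * h (i + 1)"
proof -
  let ?N = "{z\<in>V. E y z}"
  let ?C = "{z\<in>V. E y z \<and> i \<ge> 1 \<and> d x z = i - 1}"
  let ?B = "{z\<in>V. E y z \<and> d x z = i + 1}"
  let ?A = "{z\<in>V. E y z \<and> d x z = i}"
  have fin: "finite ?N" "finite ?C" "finite ?B" "finite ?A" using finite_V by auto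
  have cB: "card ?B = b i" and cC: "card ?C = c i"
    using card_dr[OF x y i] by auto
  have N: "?N = ?C \<union> ?A \<union> ?B"
  proof -
    have "i \<ge> 1 \<and> d x z = i - 1 \<or> d x z = i \<or> d x z = i + 1" if "z \<in> V" "E y z" for z
      using d_nbr[OF x y that(1) that(2)] i by arith
    then show ?thesis by auto
  qed
  have dj: "?C \<inter> ?A = {}" "(?C \<union> ?A) \<inter> ?B = {}" by auto
  have "card ?N = card ?C + card ?A + card ?B"
    unfolding N using dj fin by (simp add: card_Un_disjoint)
  then have cA: "real (card ?A) = a i" using degree[OF y] cB cC by simp
  have "(\<Sum>z\<in>?N. h (d x z)) = (\<Sum>z\<in>?C. h (d x z)) + (\<Sum>z\<in>?A. h (d x z)) + (\<Sum>z\<in>?B. h (d x z))"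
    unfolding N using dj fin by (simp add: sum.union_disjoint)
  also have "(\<Sum>z\<in>?C. h (d x z)) = c i * h (i - 1)" using cC by simp
  also have "(\<Sum>z\<in>?A. h (d x z)) = a i * h i" using cA by simp
  also have "(\<Sum>z\<in>?B. h (d x z)) = b i * h (i + 1)" using cB by simp
  finally show ?thesis .
qed

lemma card_common_nbrs_1:
  assumes x: "x \<in> V" and y: "y \<in> V" and xy: "E x y"
  shows "real (card {z\<in>V. E x z \<and> E y z}) = a 1"
proof -
  have eq: "{z\<in>V. E x z \<and> E y z} = {z \<in> {z\<in>V. E y z}. d x z = 1}"
    using d_eq_1[OF x] by auto
  have "real (card {z \<in> {z\<in>V. E y z}. d x z = 1})
      = (\<Sum>z\<in>{z \<in> {z\<in>V. E y z}. d x z = 1}. 1)" by simp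
  also have "\<dots> = (\<Sum>z\<in>{z\<in>V. E y z}. if d x z = 1 then 1 else 0)"
    using finite_V by (intro sum.inter_filter) simp
  also have "\<dots> = a 1"
    using radial_sum[OF x y, of 1 "\<lambda>j. if j = 1 then 1 else 0"] d_eq_1[OF x y] xy by simp
  finally show ?thesis unfolding eq .
qed

lemma card_common_nbrs_2:
  assumes x: "x \<in> V" and y: "y \<in> V" and xy: "d x y = 2"
  shows "card {z\<in>V. E x z \<and> E y z} = c 2"
proof -
  have eq: "{z\<in>V. E x z \<and> E y z} = {z\<in>V. E y z \<and> d x z = 1}"
    using d_eq_1[OF x] by auto
  show ?thesis unfolding eq using card_c[OF x y, of 1] xy by (simp add: numeral_2_eq_2)
qed

text \<open>\<open>sphere_size i\<close> is the number of vertices at distance \<open>i\<close> from a given vertex. Beyond \<open>D\<close>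
  both functions take junk values.\<close>

fun cosine :: "real \<Rightarrow> nat \<Rightarrow> real" where
  "cosine \<eta> 0 = 1"
| "cosine \<eta> (Suc 0) = \<eta> / b 0"
| "cosine \<eta> (Suc (Suc i)) =
    ((\<eta> - a (Suc i)) * cosine \<eta> (Suc i) - c (Suc i) * cosine \<eta> i) / b (Suc i)"

primrec sphere_size :: "nat \<Rightarrow> real" where
  "sphere_size 0 = 1"
| "sphere_size (Suc i) = sphere_size i * b i / c (Suc i)"

lemma sphere_size_pos: "i \<le> D \<Longrightarrow> sphere_size i > 0"
  by (induction i) (auto intro!: divide_pos_pos mult_pos_pos simp: b_pos c_pos)

lemma sphere_size_Suc: "i < D \<Longrightarrow> sphere_size (Suc i) * c (Suc i) = sphere_size i * b i"
  using c_pos[of "Suc i"] by simp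

lemma cosine_rec:
  "i < D \<Longrightarrow> c i * cosine \<eta> (i - 1) + a i * cosine \<eta> i + b i * cosine \<eta> (i + 1) = \<eta> * cosine \<eta> i"
  using b_pos[of i] by (cases i) (auto simp: c_0 field_simps)

section \<open>Eigenfunctions that depend on distance only\<close>

definition radial_eigen :: "real \<Rightarrow> (nat \<Rightarrow> real) \<Rightarrow> bool" where
  "radial_eigen \<eta> h \<longleftrightarrow>
    (\<forall>x\<in>V. \<forall>y\<in>V. (\<Sum>z\<in>{z\<in>V. E y z}. h (d x z)) = \<eta> * h (d x y))"

text \<open>There is one equation per distance. In the one for \<open>D\<close> the value
  \<open>h (D + 1)\<close> carries the factor \<open>b D = 0\<close>; for \<open>cosine\<close> this
  last equation is the one that singles out the eigenvalues.\<close>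

lemma radial_eigen_rec:
  fixes h :: "nat \<Rightarrow> real"
  shows "radial_eigen \<eta> h \<longleftrightarrow>
    (\<forall>i\<le>D. c i * h (i - 1) + a i * h i + b i * h (i + 1) = \<eta> * h i)"
proof
  assume h: "radial_eigen \<eta> h"
  show "\<forall>i\<le>D. c i * h (i - 1) + a i * h i + b i * h (i + 1) = \<eta> * h i"
  proof (intro allI impI)
    fix i assume "i \<le> D"
    then obtain x y where "x \<in> V" "y \<in> V" "d x y = i" using ex_d_eq by blast
    with h radial_sum[of x y i h]
    show "c i * h (i - 1) + a i * h i + b i * h (i + 1) = \<eta> * h i"
      unfolding radial_eigen_def by auto
  qed
next
  assume "\<forall>i\<le>D. c i * h (i - 1) + a i * h i + b i * h (i + 1) = \<eta> * h i"
  then show "radial_eigen \<eta> h"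
    unfolding radial_eigen_def using radial_sum d_le_D by simp
qed

text \<open>For \<open>j < D\<close> the factor \<open>b j\<close> is positive, so the three-term
  recurrence determines all values from \<open>h 0\<close>.\<close>

lemma radial_eigen_unique:
  fixes h :: "nat \<Rightarrow> real"
  assumes h: "radial_eigen \<eta> h" and "i \<le> D"
  shows "h i = h 0 * cosine \<eta> i"
  using \<open>i \<le> D\<close>
proof (induction i rule: less_induct)
  case (less i)
  show ?case
  proof (cases i)
    case (Suc j)
    then have j: "j < D" "b j > 0" using less.prems b_pos by auto
    have IH: "h j = h 0 * cosine \<eta> j" "h (j - 1) = h 0 * cosine \<eta> (j - 1)"
      using less.IH[of j] less.IH[of "j - 1"] less.prems Suc by auto
    have "b j * h (Suc j) = \<eta> * h j - c j * h (j - 1) - a j * h j"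
      using h j unfolding radial_eigen_rec by (auto simp: algebra_simps dest: spec[of _ j])
    also have "\<dots> = h 0 * (\<eta> * cosine \<eta> j - c j * cosine \<eta> (j - 1) - a j * cosine \<eta> j)"
      unfolding IH by (simp add: algebra_simps)
    also have "\<eta> * cosine \<eta> j - c j * cosine \<eta> (j - 1) - a j * cosine \<eta> j = b j * cosine \<eta> (Suc j)"
      using cosine_rec[OF j(1), of \<eta>] by simp
    finally show ?thesis using j Suc by simp
  qed simp
qed

text \<open>Counting edges from both ends turns the eigenvalue equation of \<open>f\<close> into the
  transposed recurrence for its sums over spheres; the factors \<open>sphere_size\<close> turn that
  into the recurrence of \<open>cosine\<close>.\<close>

lemma sphere_sum:
  fixes f :: "'a \<Rightarrow> real" and S :: "nat \<Rightarrow> real"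
  assumes f: "\<And>y. y \<in> V \<Longrightarrow> (\<Sum>z\<in>{z\<in>V. E y z}. f z) = \<eta> * f y"
    and x: "x \<in> V"
  defines "S \<equiv> \<lambda>i. \<Sum>y\<in>{y\<in>V. d x y = i}. f y"
  shows sphere_sum_rec: "\<eta> * S i = c (Suc i) * S (Suc i) + a i * S i
      + (if i = 0 then 0 else b (i - 1) * S (i - 1))" (is ?rec)
    and sphere_sum_cosine: "i \<le> D \<Longrightarrow> S i = sphere_size i * cosine \<eta> i * f x"
proof -
  have S: "S i = (\<Sum>y\<in>V. (if d x y = i then 1 else 0) * f y)" for i
    unfolding S_def using finite_V
    by (auto simp: sum.inter_filter intro!: sum.cong)
  show rec: "\<eta> * S i = c (Suc i) * S (Suc i) + a i * S i
      + (if i = 0 then 0 else b (i - 1) * S (i - 1))" for i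
  proof -
    let ?h = "\<lambda>j. if j = i then 1 else 0 :: real"
    have "\<eta> * S i = (\<Sum>y\<in>V. ?h (d x y) * (\<Sum>z\<in>{z\<in>V. E y z}. f z))"
      unfolding S using f by (simp add: sum_distrib_left algebra_simps)
    also have "\<dots> = (\<Sum>y\<in>V. \<Sum>z\<in>V. if E y z then ?h (d x y) * f z else 0)"
      using finite_V by (auto simp: sum_distrib_left sum.inter_filter intro!: sum.cong)
    also have "\<dots> = (\<Sum>z\<in>V. \<Sum>y\<in>V. if E y z then ?h (d x y) * f z else 0)"
      by (rule sum.swap)
    also have "\<dots> = (\<Sum>z\<in>V. (\<Sum>y\<in>{y\<in>V. E z y}. ?h (d x y)) * f z)"
      using finite_V E_sym by (auto simp: sum_distrib_right sum.inter_filter intro!: sum.cong)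
    also have "\<dots> = (\<Sum>z\<in>V. (c (Suc i) * (if d x z = Suc i then 1 else 0 :: real) + a i * ?h (d x z)
        + (if i = 0 then 0 else b (i - 1) * (if d x z = i - 1 then 1 else 0 :: real))) * f z)"
    proof (intro sum.cong arg_cong2[where f = "(*)"] refl)
      fix z assume "z \<in> V"
      then show "(\<Sum>y\<in>{y\<in>V. E z y}. ?h (d x y)) = c (Suc i) * (if d x z = Suc i then 1 else 0 :: real)
          + a i * ?h (d x z) + (if i = 0 then 0 else b (i - 1) * (if d x z = i - 1 then 1 else 0 :: real))"
        using radial_sum[OF x, of z "d x z" ?h] c_0 by (cases "d x z") auto
    qed
    also have "\<dots> = c (Suc i) * S (Suc i) + a i * S i
      + (if i = 0 then 0 else b (i - 1) * S (i - 1))"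
      unfolding S by (simp add: algebra_simps sum.distrib sum_distrib_left sum_subtractf)
    finally show ?thesis .
  qed
  show "i \<le> D \<Longrightarrow> S i = sphere_size i * cosine \<eta> i * f x"
  proof (induction i rule: less_induct)
    case (less i)
    show ?case
    proof (cases i)
      case 0
      have "{y\<in>V. d x y = 0} = {x}" using x d_eq_0 by auto
      then show ?thesis using 0 by (simp add: S_def)
    next
      case (Suc j)
      then have j: "j < D" "c (Suc j) > 0" using less.prems c_pos by auto
      have IH: "S j = sphere_size j * cosine \<eta> j * f x"
        "S (j - 1) = sphere_size (j - 1) * cosine \<eta> (j - 1) * f x"
        using less.IH[of j] less.IH[of "j - 1"] less.prems Suc by auto
      have pred: "(if j = 0 then 0 else b (j - 1) * S (j - 1))
          = sphere_size j * c j * cosine \<eta> (j - 1) * f x"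
        using sphere_size_Suc[of "j - 1"] j IH(2) by (cases j) (auto simp: c_0 algebra_simps)
      have "c (Suc j) * S (Suc j) = \<eta> * S j - a j * S j - (if j = 0 then 0 else b (j - 1) * S (j - 1))"
        using rec[of j] by simp
      also have "\<dots> = sphere_size j * f x *
          (\<eta> * cosine \<eta> j - a j * cosine \<eta> j - c j * cosine \<eta> (j - 1))"
        unfolding pred IH(1) by (simp add: algebra_simps)
      also have "\<eta> * cosine \<eta> j - a j * cosine \<eta> j - c j * cosine \<eta> (j - 1) = b j * cosine \<eta> (Suc j)"
        using cosine_rec[OF j(1), of \<eta>] by simp
      also have "sphere_size j * f x * (b j * cosine \<eta> (Suc j))
          = c (Suc j) * (sphere_size (Suc j) * cosine \<eta> (Suc j) * f x)"
        using j(2) by simp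
      finally show ?thesis using j Suc by (simp add: field_simps)
    qed
  qed
qed

text \<open>Below \<open>D\<close> the equations hold by construction of \<open>cosine\<close>. The
  one at \<open>D\<close> comes from the emptiness of the sphere of radius \<open>D + 1\<close>,
  after cancelling the nonzero \<open>f x\<close>.\<close>

lemma cosine_radial_eigen:
  fixes f :: "'a \<Rightarrow> real"
  assumes D: "D \<ge> 1"
    and f: "\<And>y. y \<in> V \<Longrightarrow> (\<Sum>z\<in>{z\<in>V. E y z}. f z) = \<eta> * f y"
    and x: "x \<in> V" "f x \<noteq> 0"
  shows "radial_eigen \<eta> (cosine \<eta>)"
  unfolding radial_eigen_rec
proof (intro allI impI)
  fix i assume i: "i \<le> D"
  show "c i * cosine \<eta> (i - 1) + a i * cosine \<eta> i + b i * cosine \<eta> (i + 1) = \<eta> * cosine \<eta> i"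
  proof (cases "i = D")
    case True
    note S = sphere_sum_cosine[OF f x(1)]
    have "{y\<in>V. d x y = Suc D} = {}" using d_le_D[OF x(1)] by fastforce
    then have "sum f {y\<in>V. d x y = Suc D} = 0" by (metis sum.empty)
    then have "\<eta> * (sphere_size D * cosine \<eta> D * f x) = a D * (sphere_size D * cosine \<eta> D * f x)
        + b (D - 1) * (sphere_size (D - 1) * cosine \<eta> (D - 1) * f x)"
      using sphere_sum_rec[OF f x(1), of D] S[of D] S[of "D - 1"] D by simp
    also have "b (D - 1) * (sphere_size (D - 1) * cosine \<eta> (D - 1) * f x)
        = sphere_size D * c D * cosine \<eta> (D - 1) * f x"
      using sphere_size_Suc[of "D - 1"] D by (simp del: sphere_size.simps)
    finally have "sphere_size D * f x * (\<eta> * cosine \<eta> D)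
        = sphere_size D * f x * (a D * cosine \<eta> D + c D * cosine \<eta> (D - 1))"
      by (simp add: algebra_simps)
    then have "\<eta> * cosine \<eta> D = a D * cosine \<eta> D + c D * cosine \<eta> (D - 1)"
      using sphere_size_pos[of D] x(2) by simp
    then show ?thesis using True b_D by simp
  next
    case False
    with i show ?thesis using cosine_rec by simp
  qed
qed

text \<open>Grouping by spheres shows that the kernel \<open>cosine \<eta> (d x y)\<close> acts on
  eigenfunctions for \<open>\<eta>\<close> as a scalar. Dividing by this scalar later gives the
  projection.\<close>

lemma sum_cosine_mult:
  fixes f :: "'a \<Rightarrow> real"
  assumes f: "\<And>y. y \<in> V \<Longrightarrow> (\<Sum>z\<in>{z\<in>V. E y z}. f z) = \<eta> * f y" and x: "x \<in> V"
  shows "(\<Sum>y\<in>V. cosine \<eta> (d x y) * f y) = (\<Sum>i\<le>D. sphere_size i * (cosine \<eta> i)\<^sup>2) * f x"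
proof -
  have "(\<Sum>y\<in>V. cosine \<eta> (d x y) * f y)
      = (\<Sum>i\<le>D. \<Sum>y\<in>{y\<in>V. d x y = i}. cosine \<eta> (d x y) * f y)"
    using finite_V d_le_D[OF x] by (intro sum.group[symmetric]) auto
  also have "\<dots> = (\<Sum>i\<le>D. cosine \<eta> i * (\<Sum>y\<in>{y\<in>V. d x y = i}. f y))"
    by (simp add: sum_distrib_left)
  also have "\<dots> = (\<Sum>i\<le>D. sphere_size i * (cosine \<eta> i)\<^sup>2 * f x)"
    using sphere_sum_cosine[OF f x] by (intro sum.cong) (auto simp: power2_eq_square)
  finally show ?thesis by (simp add: sum_distrib_right)
qed

lemma radial_eigen_cosineI:
  assumes h: "radial_eigen \<eta> h" "h 0 \<noteq> 0"
  shows "radial_eigen \<eta> (cosine \<eta>)"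
proof -
  have cos: "cosine \<eta> (d x y) = h (d x y) / h 0" if "x \<in> V" "y \<in> V" for x y
    using radial_eigen_unique[OF h(1) d_le_D[OF that]] h(2) by simp
  show ?thesis
    using h(1) unfolding radial_eigen_def by (simp add: cos flip: sum_divide_distrib)
qed

lemma radial_eigen_degree: "radial_eigen (b 0) (\<lambda>_. 1)"
  unfolding radial_eigen_def by (simp add: degree)

lemma sum_eigenfunction_eq_0:
  fixes f :: "'a \<Rightarrow> real"
  assumes f: "\<And>y. y \<in> V \<Longrightarrow> (\<Sum>z\<in>{z\<in>V. E y z}. f z) = \<eta> * f y" and "\<eta> \<noteq> b 0"
  shows "(\<Sum>y\<in>V. f y) = 0"
proof -
  have "\<eta> * (\<Sum>y\<in>V. f y) = (\<Sum>y\<in>V. \<Sum>z\<in>V. if E y z then f z else 0)"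
    using f finite_V by (simp add: sum_distrib_left sum.inter_filter)
  also have "\<dots> = (\<Sum>z\<in>V. \<Sum>y\<in>V. if E y z then f z else 0)"
    by (rule sum.swap)
  also have "\<dots> = (\<Sum>z\<in>V. \<Sum>y\<in>{y\<in>V. E z y}. f z)"
    unfolding sum.inter_filter[OF finite_V] using E_sym by (intro sum.cong) auto
  also have "\<dots> = b 0 * (\<Sum>y\<in>V. f y)"
    by (simp add: degree sum_distrib_left)
  finally show ?thesis using \<open>\<eta> \<noteq> b 0\<close> by simp
qed

end

section \<open>Idempotents and the spherical representation of an eigenvalue\<close>

lemma adj_matrix_mult:
  "(adj_matrix E *v f) $ y = (\<Sum>z\<in>{z. E y z}. f $ z)"
  unfolding adj_matrix_def matrix_vector_mult_def
  by (simp add: sum.inter_filter[of UNIV, simplified, symmetric] if_distrib[of "\<lambda>t. t * _"]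
      cong: if_cong)

text \<open>Two idempotents with the same range absorb each other, \<open>P ** Q = Q\<close> and
  \<open>Q ** P = P\<close>. Transposing the first gives \<open>Q ** P = Q\<close>, so the range
  determines the symmetric idempotent.\<close>

lemma eigenproj_eqI:
  assumes "transpose P = P" "P ** P = P" "range (\<lambda>x. P *v x) = eigenspace A \<eta>"
  shows "eigenproj A \<eta> = P"
  unfolding eigenproj_def
proof (rule the_equality)
  fix Q assume Q: "transpose Q = Q \<and> Q ** Q = Q \<and> range (\<lambda>x. Q *v x) = eigenspace A \<eta>"
  have absorb: "Q' ** P' = P'"
    if "Q' ** Q' = Q'" "range (\<lambda>x. P' *v x) = range (\<lambda>x. Q' *v x)" for P' Q' :: "real^'a^'a"
  proof -
    have "(Q' ** P') *v x = P' *v x" for x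
    proof -
      have "P' *v x \<in> range (\<lambda>x. Q' *v x)" unfolding that(2)[symmetric] by simp
      then show ?thesis using that(1) by (auto simp: image_iff) (metis matrix_vector_mul_assoc)
    qed
    then show ?thesis by (simp add: matrix_eq)
  qed
  have "Q = P ** Q" using absorb[of P Q] assms Q by simp
  then have "transpose Q = transpose Q ** transpose P" by (metis matrix_transpose_mul)
  then show "Q = P" using absorb[of Q P] assms Q by simp
qed (use assms in simp)

locale finite_drg = drg "UNIV :: 'a::finite set" E D b c for E D b c +
  assumes D_pos: "D \<ge> 1"
begin

lemma d_commute: "d x y = d y x"
  by (rule d_sym) simp_all

lemma radial_eigenD:
  "radial_eigen \<eta> h \<Longrightarrow> (\<Sum>z\<in>{z. E y z}. h (d x z)) = \<eta> * h (d x y)"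
  unfolding radial_eigen_def by simp

text \<open>For an eigenvalue this is the number of vertices divided by the multiplicity.\<close>

definition weight :: "real \<Rightarrow> real" where
  "weight \<eta> = (\<Sum>i\<le>D. sphere_size i * (cosine \<eta> i)\<^sup>2)"

lemma weight_pos: "weight \<eta> > 0"
proof -
  have "sphere_size 0 * (cosine \<eta> 0)\<^sup>2 \<le> weight \<eta>"
    unfolding weight_def
    by (rule member_le_sum) (auto intro!: mult_nonneg_nonneg less_imp_le[OF sphere_size_pos])
  then show ?thesis by simp
qed

lemma sum_cosine_eigenvector:
  assumes "adj_matrix E *v f = \<eta> *\<^sub>R f"
  shows "(\<Sum>y\<in>UNIV. cosine \<eta> (d x y) * f $ y) = weight \<eta> * f $ x"
proof -
  have "(\<Sum>z\<in>{z. E y z}. f $ z) = \<eta> * f $ y" for y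
    using assms adj_matrix_mult[of E f y] by simp
  then show ?thesis using sum_cosine_mult[of "($) f" \<eta> x] by (simp add: weight_def)
qed

lemma eigenvector_cosine:
  assumes "radial_eigen \<eta> (cosine \<eta>)"
  shows "adj_matrix E *v (\<chi> z. cosine \<eta> (d x z)) = \<eta> *\<^sub>R (\<chi> z. cosine \<eta> (d x z))"
  using radial_eigenD[OF assms] by (simp add: vec_eq_iff adj_matrix_mult)

lemma is_eigenvalue_iff:
  "is_eigenvalue (adj_matrix E) \<eta> \<longleftrightarrow> radial_eigen \<eta> (cosine \<eta>)"
proof
  assume "is_eigenvalue (adj_matrix E) \<eta>"
  then obtain f where f: "f \<noteq> 0" "adj_matrix E *v f = \<eta> *\<^sub>R f"
    unfolding is_eigenvalue_def by auto
  then obtain x where "f $ x \<noteq> 0" by (auto simp: vec_eq_iff)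
  moreover have "(\<Sum>z\<in>{z. E y z}. f $ z) = \<eta> * f $ y" for y
    using f adj_matrix_mult[of E f y] by simp
  ultimately show "radial_eigen \<eta> (cosine \<eta>)"
    using cosine_radial_eigen[OF D_pos, of "($) f" \<eta> x] by simp
next
  assume r: "radial_eigen \<eta> (cosine \<eta>)"
  have "(\<chi> z. cosine \<eta> (d x z)) \<noteq> 0" for x
    by (auto simp: vec_eq_iff intro!: exI[of _ x])
  then show "is_eigenvalue (adj_matrix E) \<eta>"
    unfolding is_eigenvalue_def using eigenvector_cosine[OF r] by blast
qed

text \<open>The columns of the kernel are eigenvectors, so its range lies in the eigenspace; it also
  fixes every eigenvector. Idempotence and the exact range follow from these two facts.\<close>

lemma eigenproj_eq:
  assumes r: "radial_eigen \<eta> (cosine \<eta>)"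
  shows "eigenproj (adj_matrix E) \<eta> = (\<chi> x y. cosine \<eta> (d x y) / weight \<eta>)" (is "_ = ?P")
proof (rule eigenproj_eqI)
  have fixes_eig: "?P *v f = f" if "adj_matrix E *v f = \<eta> *\<^sub>R f" for f
    using sum_cosine_eigenvector[OF that] weight_pos[of \<eta>]
    by (simp add: vec_eq_iff matrix_vector_mult_def sum_divide_distrib[symmetric])
  show sym: "transpose ?P = ?P"
    by (simp add: vec_eq_iff transpose_def d_commute)
  have eig: "adj_matrix E *v (?P *v f) = \<eta> *\<^sub>R (?P *v f)" for f
  proof -
    have "(\<Sum>z\<in>{z. E y z}. \<Sum>x\<in>UNIV. cosine \<eta> (d z x) * f $ x / weight \<eta>)
        = \<eta> * (\<Sum>x\<in>UNIV. cosine \<eta> (d y x) * f $ x / weight \<eta>)" for y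
    proof -
      have "(\<Sum>z\<in>{z. E y z}. \<Sum>x\<in>UNIV. cosine \<eta> (d z x) * f $ x / weight \<eta>)
          = (\<Sum>x\<in>UNIV. \<Sum>z\<in>{z. E y z}. cosine \<eta> (d x z) * f $ x / weight \<eta>)"
        by (subst sum.swap) (simp add: d_commute)
      also have "\<dots> = (\<Sum>x\<in>UNIV. (\<Sum>z\<in>{z. E y z}. cosine \<eta> (d x z)) * f $ x / weight \<eta>)"
        by (simp add: sum_distrib_right sum_divide_distrib)
      also have "\<dots> = (\<Sum>x\<in>UNIV. \<eta> * cosine \<eta> (d x y) * f $ x / weight \<eta>)"
        using radial_eigenD[OF r] by simp
      also have "\<dots> = \<eta> * (\<Sum>x\<in>UNIV. cosine \<eta> (d y x) * f $ x / weight \<eta>)"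
        by (simp add: sum_distrib_left d_commute mult.assoc)
      finally show ?thesis .
    qed
    then show ?thesis
      unfolding vec_eq_iff adj_matrix_mult by (simp add: matrix_vector_mult_def)
  qed
  show "?P ** ?P = ?P"
  proof -
    have "(?P ** ?P) *v f = ?P *v f" for f
      using fixes_eig[OF eig[of f]] by (simp add: matrix_vector_mul_assoc[symmetric])
    then show ?thesis by (simp add: matrix_eq)
  qed
  show "range (\<lambda>f. ?P *v f) = eigenspace (adj_matrix E) \<eta>"
    unfolding eigenspace_def using eig fixes_eig by (auto simp: image_iff) metis
qed

text \<open>These are the columns of the idempotent, multiplied by
  \<open>sqrt (weight \<eta>)\<close> to become unit vectors.\<close>

definition rep :: "real \<Rightarrow> 'a \<Rightarrow> real^'a" where
  "rep \<eta> x = (\<chi> y. cosine \<eta> (d x y) / sqrt (weight \<eta>))"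

lemma inner_rep:
  assumes r: "radial_eigen \<eta> (cosine \<eta>)"
  shows "rep \<eta> x \<bullet> rep \<eta> y = cosine \<eta> (d x y)"
proof -
  have "rep \<eta> x \<bullet> rep \<eta> y = (\<Sum>z\<in>UNIV. cosine \<eta> (d x z) * cosine \<eta> (d y z)) / weight \<eta>"
    using weight_pos[of \<eta>] by (simp add: rep_def inner_vec_def sum_divide_distrib)
  also have "\<dots> = cosine \<eta> (d x y)"
    using sum_cosine_eigenvector[OF eigenvector_cosine[OF r, of y], of x] weight_pos[of \<eta>]
    by (simp add: d_commute)
  finally show ?thesis .
qed

lemma sum_rep_nbrs:
  assumes r: "radial_eigen \<eta> (cosine \<eta>)"
  shows "(\<Sum>z\<in>{z. E y z}. rep \<eta> z) = \<eta> *\<^sub>R rep \<eta> y"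
proof -
  have "(\<Sum>z\<in>{z. E y z}. cosine \<eta> (d z x)) = \<eta> * cosine \<eta> (d y x)" for x
    using radial_eigenD[OF r, of x y] by (simp only: d_commute[of _ x])
  then show ?thesis
    by (simp add: vec_eq_iff rep_def sum_divide_distrib[symmetric])
qed

lemma gram_nonneg:
  assumes r: "radial_eigen \<eta> (cosine \<eta>)" and "finite S"
  shows "(\<Sum>x\<in>S. \<Sum>y\<in>S. g x * g y * cosine \<eta> (d x y)) \<ge> 0"
proof -
  have "(\<Sum>x\<in>S. \<Sum>y\<in>S. g x * g y * cosine \<eta> (d x y))
      = (\<Sum>x\<in>S. g x *\<^sub>R rep \<eta> x) \<bullet> (\<Sum>x\<in>S. g x *\<^sub>R rep \<eta> x)"
    by (simp add: inner_sum_left inner_sum_right inner_rep[OF r] sum_distrib_left mult.assoc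
        d_commute)
  then show ?thesis by simp
qed

end

section \<open>The light tail\<close>

locale tight_drg = finite_drg E D b c for E :: "'a::finite \<Rightarrow> 'a \<Rightarrow> bool" and D b c +
  fixes s :: real
  assumes D_ge_2: "D \<ge> 2" and a_1: "a 1 = s - 1" and s_gt_1: "s > 1" and c_2: "c 2 = s\<^sup>2 + 1"
    and eigen: "radial_eigen (- (b 0 / s)) (cosine (- (b 0 / s)))"
begin

abbreviation k :: real where "k \<equiv> b 0"

abbreviation u :: "nat \<Rightarrow> real" where "u \<equiv> cosine (- (k / s))"

abbreviation w :: "'a \<Rightarrow> real^'a" where "w \<equiv> rep (- (k / s))"

text \<open>The value claimed for the second largest eigenvalue.\<close>

definition \<rho> :: real where "\<rho> = (k - s * (s + 1)) / s\<^sup>2"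

definition \<beta> :: real where "\<beta> = (s + 1) / s"

lemma inner_w: "w x \<bullet> w y = u (d x y)"
  by (rule inner_rep[OF eigen])

lemma k_pos: "k > 0"
  using b_pos[of 0] D_pos by simp

lemma b_1: "b 1 = k - s" "k - s > 0"
proof -
  show "b 1 = k - s" using a_1 c_1[OF D_pos] by simp
  then show "k - s > 0" using b_pos[of 1] D_ge_2 by simp
qed

lemma u_1: "u 1 = - (1 / s)"
  using k_pos by simp

lemma u_2: "u 2 = 1 / s\<^sup>2"
proof -
  have "1 + (s - 1) * u 1 + (k - s) * u 2 = - (k / s) * u 1"
    using cosine_rec[of 1 "- (k / s)"] D_ge_2 a_1 b_1 c_1[OF D_pos] by (simp add: numeral_2_eq_2)
  then have "(k - s) * u 2 = k / s\<^sup>2 - 1 + (s - 1) / s"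
    unfolding u_1 by (simp add: power2_eq_square)
  also have "\<dots> = (k - s) * (1 / s\<^sup>2)"
    using s_gt_1 by (simp add: field_simps power2_eq_square)
  finally have "(k - s) * u 2 = (k - s) * (1 / s\<^sup>2)" .
  then show ?thesis using b_1(2) by (metis less_irrefl mult_left_cancel)
qed

lemma u_nbr: "E x y \<Longrightarrow> u (d x y) = - (1 / s)"
  using d_eq_1[of x y] u_1 by simp

lemma u_common_nbr:
  assumes "E x y" "E x z"
  shows "u (d y z) = (if y = z then 1 else if E y z then - (1 / s) else 1 / s\<^sup>2)"
  using d_eq_2[of y z x] u_2 u_nbr[of y z] assms E_sym[of x y] by auto

text \<open>The squared norm of \<open>\<Sum> w z + s (w x + w y)\<close>, summed over the common neighbours \<open>z\<close>, is at
  most 0, and negative if two of the \<open>z\<close> are adjacent; \<open>c\<^sub>2 = s\<^sup>2 + 1\<close> is exactly what makes it so.\<close>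

lemma
  assumes xy: "d x y = 2"
  shows distance_2_coclique: "E x z \<Longrightarrow> E y z \<Longrightarrow> E x z' \<Longrightarrow> E y z' \<Longrightarrow> \<not> E z z'"
    and sum_w_common_nbrs: "(\<Sum>z\<in>{z. E x z \<and> E y z}. w z) = - s *\<^sub>R (w x + w y)"
proof -
  let ?C = "{z. E x z \<and> E y z}"
  have card: "real (card ?C) = s\<^sup>2 + 1"
    using card_common_nbrs_2[of x y] xy c_2 by simp
  let ?v = "(\<Sum>z\<in>?C. w z)"
  \<comment> \<open>The first term is the Gram entry that a coclique would have. Only adjacent pairs
    deviate from it, and always in the same direction.\<close>
  let ?f = "\<lambda>z z'. (if z = z' then 1 else 1 / s\<^sup>2) - u (d z z')"
  have f: "?f z z' \<ge> 0" "E z z' \<Longrightarrow> ?f z z' > 0" if "z \<in> ?C" "z' \<in> ?C" for z z'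
  proof -
    have lt: "- (1 / s) < 1 / s\<^sup>2"
      by (rule less_trans[of _ 0]) (use s_gt_1 in auto)
    have u: "u (d z z') = (if z = z' then 1 else if E z z' then - (1 / s) else 1 / s\<^sup>2)"
      using u_common_nbr[of x z z'] that by simp
    show "?f z z' \<ge> 0" unfolding u using lt by (cases "E z z'") simp_all
    assume "E z z'"
    then have "z \<noteq> z'" using E_irrefl[of z] by auto
    with \<open>E z z'\<close> show "?f z z' > 0" unfolding u using lt by simp
  qed
  \<comment> \<open>The diagonal contributes 1, and the other \<open>s\<^sup>2\<close> common
    neighbours contribute \<open>1 / s\<^sup>2\<close> each.\<close>
  have row: "(\<Sum>z'\<in>?C. if z = z' then 1 else 1 / s\<^sup>2) = 2" if "z \<in> ?C" for z
  proof -
    have "(\<Sum>z'\<in>?C. if z = z' then 1 else 1 / s\<^sup>2)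
        = (\<Sum>z'\<in>?C. 1 / s\<^sup>2 + (if z = z' then 1 - 1 / s\<^sup>2 else 0))"
      by (intro sum.cong) auto
    also have "\<dots> = (s\<^sup>2 + 1) / s\<^sup>2 + (1 - 1 / s\<^sup>2)"
      using that card by (simp add: sum.distrib)
    also have "\<dots> = 2" using s_gt_1 by (simp add: field_simps)
    finally show ?thesis .
  qed
  have vv: "?v \<bullet> ?v = (\<Sum>z\<in>?C. \<Sum>z'\<in>?C. u (d z z'))"
    by (simp add: inner_sum_left inner_sum_right inner_w d_commute)
  have "(\<Sum>z\<in>?C. \<Sum>z'\<in>?C. ?f z z') = (\<Sum>z\<in>?C. 2) - ?v \<bullet> ?v"
    unfolding vv sum_subtractf using row by simp
  then have sum_f: "(\<Sum>z\<in>?C. \<Sum>z'\<in>?C. ?f z z') = 2 * (s\<^sup>2 + 1) - ?v \<bullet> ?v"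
    using card by simp
  have vx: "?v \<bullet> w x = - ((s\<^sup>2 + 1) / s)" "?v \<bullet> w y = - ((s\<^sup>2 + 1) / s)"
    using card u_nbr[of x] u_nbr[of y]
    by (simp_all add: inner_sum_left inner_w d_commute[of _ x] d_commute[of _ y])
  have "(?v + s *\<^sub>R (w x + w y)) \<bullet> (?v + s *\<^sub>R (w x + w y))
      = ?v \<bullet> ?v + 2 * s * (?v \<bullet> w x + ?v \<bullet> w y) + s\<^sup>2 * (2 + 2 * u (d x y))"
    by (simp add: inner_w algebra_simps inner_commute power2_eq_square d_commute)
  also have "\<dots> = ?v \<bullet> ?v - 2 * (s\<^sup>2 + 1)"
    unfolding vx xy u_2 using s_gt_1 by (simp add: field_simps)
  also have "\<dots> = - (\<Sum>z\<in>?C. \<Sum>z'\<in>?C. ?f z z')"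
    using sum_f by simp
  finally have norm: "(?v + s *\<^sub>R (w x + w y)) \<bullet> (?v + s *\<^sub>R (w x + w y))
      = - (\<Sum>z\<in>?C. \<Sum>z'\<in>?C. ?f z z')" .
  have "(\<Sum>z\<in>?C. \<Sum>z'\<in>?C. ?f z z') \<ge> 0"
    using f(1) by (intro sum_nonneg) blast
  moreover have "(?v + s *\<^sub>R (w x + w y)) \<bullet> (?v + s *\<^sub>R (w x + w y)) \<ge> 0" by simp
  ultimately have zero: "(\<Sum>z\<in>?C. \<Sum>z'\<in>?C. ?f z z') = 0"
    "(?v + s *\<^sub>R (w x + w y)) \<bullet> (?v + s *\<^sub>R (w x + w y)) = 0"
    using norm by linarith+
  then show "?v = - s *\<^sub>R (w x + w y)"
    by (simp add: eq_neg_iff_add_eq_0)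
  assume "E x z" "E y z" "E x z'" "E y z'"
  then have zz: "z \<in> ?C" "z' \<in> ?C" by auto
  have "(\<Sum>z'\<in>?C. ?f z z') = 0"
    using zero(1) zz f(1) by (subst (asm) sum_nonneg_eq_0_iff) (auto intro!: sum_nonneg)
  then have "?f z z' = 0"
    using zz f(1)[OF zz(1)] by (subst (asm) sum_nonneg_eq_0_iff) auto
  then show "\<not> E z z'" using f(2)[OF zz] by auto
qed

text \<open>Otherwise \<open>z\<close> and \<open>z'\<close> would be at distance 2 with the
  adjacent common neighbours \<open>x\<close> and \<open>y\<close>.\<close>

lemma common_nbrs_clique:
  assumes "E x y" "E x z" "E y z" "E x z'" "E y z'" "z \<noteq> z'"
  shows "E z z'"
  using distance_2_coclique[of z z' x y] d_eq_2[of z z' x] assms E_sym by blast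

text \<open>The edge and its common neighbours form a clique of \<open>s + 1\<close> vertices. Each
  row of its Gram matrix sums to \<open>1 - s * (1 / s) = 0\<close>, so the vectors sum to a vector
  of norm 0.\<close>

lemma sum_w_clique:
  assumes xy: "E x y"
  shows "(\<Sum>z\<in>{z. E x z \<and> E y z}. w z) = - w x - w y"
proof -
  let ?C = "{z. E x z \<and> E y z}"
  let ?K = "insert x (insert y ?C)"
  have xy': "x \<noteq> y" "x \<notin> ?C" "y \<notin> ?C" using xy E_irrefl by auto
  have card: "real (card ?K) = s + 1"
    using card_common_nbrs_1[of x y] xy xy' a_1 by simp
  have clique: "E z z'" if "z \<in> ?K" "z' \<in> ?K" "z \<noteq> z'" for z z'
    using that xy common_nbrs_clique[OF xy, of z z'] E_sym by auto
  have row: "(\<Sum>z'\<in>?K. u (d z z')) = 0" if z: "z \<in> ?K" for z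
  proof -
    have "(\<Sum>z'\<in>?K. u (d z z')) = (\<Sum>z'\<in>?K. - (1 / s) + (if z = z' then 1 + 1 / s else 0))"
      using clique[OF z] u_nbr[of z] by (intro sum.cong refl) auto
    also have "\<dots> = - ((s + 1) / s) + (1 + 1 / s)"
      unfolding sum.distrib sum_constant card using z by (subst sum.delta') auto
    also have "\<dots> = 0" using s_gt_1 by (simp add: field_simps)
    finally show ?thesis .
  qed
  have "(\<Sum>z\<in>?K. w z) \<bullet> (\<Sum>z\<in>?K. w z) = (\<Sum>z\<in>?K. \<Sum>z'\<in>?K. u (d z z'))"
    unfolding inner_sum_left inner_sum_right inner_w by (simp only: d_commute)
  also have "\<dots> = 0" using row by (intro sum.neutral) blast
  finally have "(\<Sum>z\<in>?K. w z) = 0" by simp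
  then have "w x + (w y + (\<Sum>z\<in>?C. w z)) = 0" using xy' by simp
  moreover have "(\<Sum>z\<in>?C. w z) = w x + (w y + (\<Sum>z\<in>?C. w z)) - w x - w y" by simp
  ultimately show ?thesis by (simp only: diff_0)
qed

section \<open>The frame operator of a neighbourhood\<close>

definition frame :: "'a \<Rightarrow> (real^'a) set" where
  "frame y = {v. (\<Sum>z\<in>{z. E y z}. (w z \<bullet> v) *\<^sub>R w z) = (\<rho> * (w y \<bullet> v)) *\<^sub>R w y + \<beta> *\<^sub>R v}"

text \<open>\<open>frame y\<close> is the kernel of a linear map. Hence the identity needs checking
  only on \<open>w y\<close> and on the vectors of its neighbours, and then spreads along linear
  relations.\<close>

lemma subspace_frame: "subspace (frame y)"
proof -
  let ?M = "\<lambda>v. (\<Sum>z\<in>{z. E y z}. (w z \<bullet> v) *\<^sub>R w z) - (\<rho> * (w y \<bullet> v)) *\<^sub>R w y - \<beta> *\<^sub>R v"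
  have "linear ?M"
    by (intro linear_compose_sub linear_compose_sum ballI)
       (auto intro!: linearI simp: inner_add_right algebra_simps)
  then have "subspace {v. ?M v = 0}" by (rule linear_subspace_kernel)
  also have "{v. ?M v = 0} = frame y"
    unfolding frame_def by (auto simp: algebra_simps)
  finally show ?thesis .
qed

lemma \<rho>_add_\<beta>: "\<rho> + \<beta> = k / s\<^sup>2"
  unfolding \<rho>_def \<beta>_def using s_gt_1 by (simp add: field_simps power2_eq_square)

lemma w_self_in_frame: "w y \<in> frame y"
proof -
  have "(\<Sum>z\<in>{z. E y z}. (w z \<bullet> w y) *\<^sub>R w z) = (\<Sum>z\<in>{z. E y z}. (- (1 / s)) *\<^sub>R w z)"
    using u_nbr[of y] by (intro sum.cong) (auto simp: inner_w d_commute[of _ y])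
  also have "\<dots> = (- (1 / s)) *\<^sub>R (\<Sum>z\<in>{z. E y z}. w z)"
    by (simp only: scaleR_sum_right)
  also have "\<dots> = (k / s\<^sup>2) *\<^sub>R w y"
    unfolding sum_rep_nbrs[OF eigen] by (simp add: power2_eq_square)
  also have "\<dots> = \<rho> *\<^sub>R w y + \<beta> *\<^sub>R w y"
    by (simp add: \<rho>_add_\<beta>[symmetric] scaleR_add_left)
  finally show ?thesis by (simp add: frame_def inner_w)
qed

text \<open>For \<open>z\<close> adjacent to \<open>y\<close> the coefficient
  \<open>w z \<bullet> w x\<close> is \<open>1 / s\<^sup>2\<close>, corrected at
  \<open>z = x\<close> and at the neighbours of \<open>x\<close>. The eigenvalue equation evaluates
  the main part, and the clique relation the second correction.\<close>

lemma w_nbr_in_frame: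
  assumes yx: "E y x"
  shows "w x \<in> frame y"
proof -
  let ?C = "{z. E y z \<and> E x z}"
  let ?N = "{z. E y z}"
  have "(\<Sum>z\<in>?N. (w z \<bullet> w x) *\<^sub>R w z)
      = (\<Sum>z\<in>?N. (1 / s\<^sup>2) *\<^sub>R w z + (if z = x then (1 - 1 / s\<^sup>2) *\<^sub>R w z else 0)
          + (if E x z then (- (1 / s) - 1 / s\<^sup>2) *\<^sub>R w z else 0))"
    using u_common_nbr[OF yx] E_irrefl[of x]
    by (intro sum.cong refl) (auto simp: inner_w d_commute[of _ x] simp flip: scaleR_add_left)
  also have "\<dots> = (1 / s\<^sup>2) *\<^sub>R (\<Sum>z\<in>?N. w z) + (1 - 1 / s\<^sup>2) *\<^sub>R w x
      + (- (1 / s) - 1 / s\<^sup>2) *\<^sub>R (\<Sum>z\<in>?C. w z)"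
  proof -
    have "(\<Sum>z\<in>?N. if z = x then (1 - 1 / s\<^sup>2) *\<^sub>R w z else 0) = (1 - 1 / s\<^sup>2) *\<^sub>R w x"
      using yx by simp
    moreover have "(\<Sum>z\<in>?N. if E x z then (- (1 / s) - 1 / s\<^sup>2) *\<^sub>R w z else 0)
        = (- (1 / s) - 1 / s\<^sup>2) *\<^sub>R (\<Sum>z\<in>?C. w z)"
      by (simp only: scaleR_sum_right) (simp add: sum.inter_filter[symmetric])
    moreover have "(\<Sum>z\<in>?N. (1 / s\<^sup>2) *\<^sub>R w z) = (1 / s\<^sup>2) *\<^sub>R (\<Sum>z\<in>?N. w z)"
      by (simp only: scaleR_sum_right)
    ultimately show ?thesis by (simp only: sum.distrib)
  qed
  also have "\<dots> = (1 / s\<^sup>2 * - (k / s) + (1 / s + 1 / s\<^sup>2)) *\<^sub>R w y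
      + (1 - 1 / s\<^sup>2 + (1 / s + 1 / s\<^sup>2)) *\<^sub>R w x"
    unfolding sum_rep_nbrs[OF eigen] sum_w_clique[OF yx] by (simp add: algebra_simps)
  also have "1 / s\<^sup>2 * - (k / s) + (1 / s + 1 / s\<^sup>2) = \<rho> * - (1 / s)"
    unfolding \<rho>_def using s_gt_1 by (simp add: field_simps power2_eq_square)
  also have "1 - 1 / s\<^sup>2 + (1 / s + 1 / s\<^sup>2) = \<beta>"
    unfolding \<beta>_def using s_gt_1 by (simp add: field_simps)
  finally show ?thesis
    using u_nbr[OF yx] by (simp add: frame_def inner_w)
qed

text \<open>Each \<open>w x\<close> lies in the span of the \<open>w z\<close> with \<open>z\<close> equal or adjacent to \<open>y\<close>:
  the relation for vertices at distance 2 expresses \<open>w x\<close> by vertices closer to \<open>y\<close>.\<close>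

lemma w_in_frame: "w x \<in> frame y"
proof (induction "d y x" arbitrary: x rule: less_induct)
  case less
  consider "d y x = 0" | "d y x = 1" | i where "d y x = Suc (Suc i)"
    by (metis One_nat_def not0_implies_Suc)
  then show ?case
  proof cases
    case 1
    then show ?thesis using d_eq_0[of y x] w_self_in_frame by simp
  next
    case 2
    then show ?thesis using d_eq_1[of y x] w_nbr_in_frame by simp
  next
    case (3 i)
    \<comment> \<open>Two steps back on a geodesic lead to \<open>x'\<close> at distance
      \<open>i\<close> from \<open>y\<close>. All common neighbours of \<open>x\<close> and
      \<open>x'\<close> are then within distance \<open>i + 1\<close>, so the induction hypothesis
      covers them.\<close>
    obtain z where z: "E x z" "d y z = Suc i" using d_pred[of y x "Suc i"] 3 by auto
    obtain x' where x': "E z x'" "d y x' = i" using d_pred[of y z i] z by auto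
    have ne: "x \<noteq> x'" "\<not> E x x'" using x' 3 d_nbr[of y x x'] d_nbr[of y x' x] by auto
    then have xx': "d x x' = 2" using d_eq_2[of x x' z] z x' by simp
    let ?C = "{z. E x z \<and> E x' z}"
    have "w z \<in> frame y" if "z \<in> ?C" for z
      using less[of z] that 3 x' d_nbr[of y x' z] by simp
    then have "(\<Sum>z\<in>?C. w z) \<in> frame y"
      by (intro subspace_sum[OF subspace_frame])
    moreover have "w x' \<in> frame y" using less[of x'] 3 x' by simp
    ultimately have "(- (1 / s)) *\<^sub>R (\<Sum>z\<in>?C. w z) - w x' \<in> frame y"
      by (intro subspace_diff[OF subspace_frame] subspace_scale[OF subspace_frame])
    also have "(- (1 / s)) *\<^sub>R (\<Sum>z\<in>?C. w z) - w x' = w x"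
      unfolding sum_w_common_nbrs[OF xx'] using s_gt_1 by (simp add: algebra_simps)
    finally show ?thesis .
  qed
qed

text \<open>This is the frame identity at \<open>w x\<close>, paired once more with
  \<open>w x\<close>.\<close>

lemma sum_u_square: "(\<Sum>z\<in>{z. E y z}. (u (d x z))\<^sup>2) = \<rho> * (u (d x y))\<^sup>2 + \<beta>"
proof -
  have "(\<Sum>z\<in>{z. E y z}. (w z \<bullet> w x) *\<^sub>R w z) \<bullet> w x
      = ((\<rho> * (w y \<bullet> w x)) *\<^sub>R w y + \<beta> *\<^sub>R w x) \<bullet> w x"
    using w_in_frame[of x y] by (simp add: frame_def)
  then show ?thesis
    by (simp add: inner_sum_left inner_add_left inner_w power2_eq_square d_commute)
qed

text \<open>The constant \<open>t\<close> solving \<open>k * t = \<beta> + \<rho> * t\<close>: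
  subtracting it from the squared cosines removes the inhomogeneous term
  \<open>\<beta>\<close>.\<close>

definition shift :: real where "shift = \<beta> / (k - \<rho>)"

lemma \<rho>_shift: "\<rho> < k" "0 < shift" "shift < 1"
proof -
  have eq: "k - \<rho> = (s + 1) * (k * (s - 1) + s) / s\<^sup>2"
    unfolding \<rho>_def using s_gt_1 by (simp add: field_simps power2_eq_square)
  have pos: "k * (s - 1) > 0" using k_pos s_gt_1 by simp
  then have "(s + 1) * (k * (s - 1) + s) / s\<^sup>2 > 0"
    using s_gt_1 by (intro divide_pos_pos mult_pos_pos) auto
  then show "\<rho> < k" using eq by linarith
  have "shift = s / (k * (s - 1) + s)"
    unfolding shift_def eq \<beta>_def using s_gt_1 pos by (simp add: divide_simps power2_eq_square)
  then show "0 < shift" "shift < 1" using pos s_gt_1 by simp_all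
qed

lemma radial_eigen_\<rho>: "radial_eigen \<rho> (\<lambda>i. (u i)\<^sup>2 - shift)"
proof -
  have "k * shift = \<beta> + \<rho> * shift"
    unfolding shift_def using \<rho>_shift(1) by (simp add: field_simps)
  then show ?thesis
    unfolding radial_eigen_def
    by (simp add: sum_subtractf sum_u_square degree[simplified] algebra_simps)
qed

lemma u_square: "i \<le> D \<Longrightarrow> (u i)\<^sup>2 = shift + (1 - shift) * cosine \<rho> i"
  using radial_eigen_unique[OF radial_eigen_\<rho>, of i] by simp

lemma radial_eigen_cosine_\<rho>: "radial_eigen \<rho> (cosine \<rho>)"
  by (rule radial_eigen_cosineI[OF radial_eigen_\<rho>]) (use \<rho>_shift in simp)

text \<open>Entrywise this is \<open>u_square\<close>. Both coefficients are nonzero because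
  \<open>shift\<close> lies strictly between 0 and 1.\<close>

lemma light_tail:
  "light_tail_with (adj_matrix E) (eigenproj (adj_matrix E) k)
    (eigenproj (adj_matrix E) (- (k / s))) (eigenproj (adj_matrix E) \<rho>)"
proof -
  let ?A = "adj_matrix E"
  have k_eigen: "radial_eigen k (cosine k)"
    by (rule radial_eigen_cosineI[OF radial_eigen_degree]) simp
  have cos_k: "cosine k (d x y) = 1" for x y
    using radial_eigen_unique[OF radial_eigen_degree d_le_D[of x y]] by simp
  note proj = eigenproj_eq[OF k_eigen] eigenproj_eq[OF eigen] eigenproj_eq[OF radial_eigen_cosine_\<rho>]
  have "eigenproj ?A \<rho> \<noteq> eigenproj ?A k"
  proof
    assume eq: "eigenproj ?A \<rho> = eigenproj ?A k"
    obtain x y where xy: "d x y = 1" using ex_d_eq[of 1] D_pos by auto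
    have entry: "cosine \<rho> (d x y) / weight \<rho> = 1 / weight k" for x y
      using eq by (simp add: proj vec_eq_iff cos_k)
    \<comment> \<open>Diagonal entries show that the weights agree; an entry at distance 1 then
      forces \<open>\<rho> / k = 1\<close>.\<close>
    have "weight \<rho> = weight k" using entry[of x x] by simp
    then have "cosine \<rho> 1 = 1" using entry[of x y] xy weight_pos[of k] by (auto simp del: cosine.simps)
    then show False using \<rho>_shift(1) k_pos by simp
  qed
  moreover have "\<exists>p q. p \<noteq> 0 \<and> q \<noteq> 0 \<and> hadamard (eigenproj ?A (- (k / s))) (eigenproj ?A (- (k / s)))
      = p *\<^sub>R eigenproj ?A k + q *\<^sub>R eigenproj ?A \<rho>"
  proof (intro exI conjI)
    let ?W = "weight (- (k / s))"
    show "weight k * shift / ?W\<^sup>2 \<noteq> 0" "weight \<rho> * (1 - shift) / ?W\<^sup>2 \<noteq> 0"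
      using weight_pos[of k] weight_pos[of \<rho>] weight_pos[of "- (k / s)"] \<rho>_shift by auto
    have "u (d x y) / ?W * (u (d x y) / ?W) = weight k * shift / ?W\<^sup>2 * (1 / weight k)
        + weight \<rho> * (1 - shift) / ?W\<^sup>2 * (cosine \<rho> (d x y) / weight \<rho>)" for x y
    proof -
      have "u (d x y) / ?W * (u (d x y) / ?W) = (shift + (1 - shift) * cosine \<rho> (d x y)) / ?W\<^sup>2"
        using u_square[OF d_le_D[of x y]] by (simp add: power2_eq_square)
      then show ?thesis
        using weight_pos[of k] weight_pos[of \<rho>] by (simp add: add_divide_distrib)
    qed
    then show "hadamard (eigenproj ?A (- (k / s))) (eigenproj ?A (- (k / s)))
      = (weight k * shift / ?W\<^sup>2) *\<^sub>R eigenproj ?A k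
        + (weight \<rho> * (1 - shift) / ?W\<^sup>2) *\<^sub>R eigenproj ?A \<rho>"
      by (simp add: proj hadamard_def vec_eq_iff cos_k)
  qed
  ultimately show ?thesis
    unfolding light_tail_with_def minimal_idempotent_def
    using eigen radial_eigen_cosine_\<rho> is_eigenvalue_iff by blast
qed

text \<open>On a \<open>GQ(s, s\<^sup>2)\<close> the function \<open>(-1/s) ^ dist\<close> is an eigenfunction for the smallest
  eigenvalue \<open>-(s\<^sup>2 + 1)\<close>, hence also an eigenvector of the Gram matrix belonging to \<open>\<eta>\<close>.
  Its eigenvalue there is a positive multiple of \<open>(\<eta> - k) * (\<eta> - \<rho>)\<close>.\<close>

lemma GQ_eigenvalue_bound:
  assumes GQ: "is_GQ S E n (n\<^sup>2)" and n: "s = real n" and \<eta>: "radial_eigen \<eta> (cosine \<eta>)"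
  shows "(\<eta> - k) * (\<eta> - \<rho>) \<ge> 0"
proof -
  obtain b' c' where dr': "distance_regular S E 2 b' c'"
    and b'0: "b' 0 = (n\<^sup>2 + 1) * n" and b'1: "b' 1 = n\<^sup>2 * n" and c'1: "c' 1 = 1"
    and c'2: "c' 2 = n\<^sup>2 + 1"
    using GQ unfolding is_GQ_def by blast
  interpret Q: drg S E 2 b' c' by unfold_locales (rule dr')
  let ?c1 = "cosine \<eta> 1" and ?c2 = "cosine \<eta> 2"
  \<comment> \<open>Distances in \<open>S\<close> agree with those in the whole graph: distinct
    nonadjacent vertices of \<open>S\<close> have a common neighbour in \<open>S\<close>.\<close>
  have cos: "cosine \<eta> (d x y) = (if x = y then 1 else if E x y then ?c1 else ?c2)"
    if xy: "x \<in> S" "y \<in> S" for x y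
  proof -
    have "Q.d x y \<le> 2" by (rule Q.d_le_D[OF xy])
    then consider "Q.d x y = 0" | "Q.d x y = 1" | "Q.d x y = Suc 1" by linarith
    then show ?thesis
    proof cases
      case 1
      then show ?thesis using Q.d_eq_0[OF xy] by simp
    next
      case 2
      then have "E x y" using Q.d_eq_1[OF xy] by simp
      then show ?thesis using d_eq_1[of x y] E_irrefl[of x] by auto
    next
      case 3
      obtain z where z: "z \<in> S" "E y z" "Q.d x z = 1" using Q.d_pred[OF xy 3] by blast
      have "x \<noteq> y" "\<not> E x y" using 3 Q.d_eq_0[OF xy] Q.d_eq_1[OF xy] by auto
      moreover have "E x z" "E z y" using z Q.d_eq_1[of x z] E_sym[of y z] xy by auto
      ultimately show ?thesis using d_eq_2[of x y z] by simp
    qed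
  qed
  let ?g = "\<lambda>i. (- (1 / s)) ^ i"
  have g: "Q.radial_eigen (- (s\<^sup>2 + 1)) ?g"
    unfolding Q.radial_eigen_rec
  proof (intro allI impI)
    fix i :: nat assume "i \<le> 2"
    then consider "i = 0" | "i = 1" | "i = 2" by linarith
    then show "c' i * ?g (i - 1) + Q.a i * ?g i + b' i * ?g (i + 1) = - (s\<^sup>2 + 1) * ?g i"
    proof cases
      case 1
      then show ?thesis using s_gt_1 by (simp add: Q.c_0 b'0 n[symmetric] field_simps)
    next
      case 2
      then show ?thesis using s_gt_1
        by (simp add: b'0 b'1 c'1[simplified] b'1[simplified] n[symmetric] field_simps power2_eq_square)
    next
      case 3
      then show ?thesis using s_gt_1
        by (simp add: b'0 c'2 Q.b_D n[symmetric] field_simps power2_eq_square)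
    qed
  qed
  obtain p where p: "p \<in> S" using Q.V_nonempty by auto
  define G where "G x = ?g (Q.d p x)" for x
  have G: "(\<Sum>z\<in>{z\<in>S. E y z}. G z) = - (s\<^sup>2 + 1) * G y" if "y \<in> S" for y
    using g p that unfolding Q.radial_eigen_def G_def by blast
  \<comment> \<open>A negative eigenvalue differs from the valency of the quadrangle, so
    \<open>G\<close> is orthogonal to the constants.\<close>
  have "- (s\<^sup>2 + 1) < real (b' 0)"
    using zero_le_power2[of s] of_nat_0_le_iff[of "b' 0"] by linarith
  then have "- (s\<^sup>2 + 1) \<noteq> real (b' 0)" by simp
  then have sum_G: "(\<Sum>y\<in>S. G y) = 0"
    using Q.sum_eigenfunction_eq_0[OF G] by blast
  \<comment> \<open>On \<open>S\<close> the Gram matrix is \<open>?c2\<close> times all-ones, plus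
    \<open>1 - ?c2\<close> times the identity, plus \<open>?c1 - ?c2\<close> times the adjacency
    matrix. \<open>\<mu>\<close> is its eigenvalue on \<open>G\<close>.\<close>
  define \<mu> where "\<mu> = 1 - ?c2 - (s\<^sup>2 + 1) * (?c1 - ?c2)"
  have row: "(\<Sum>y\<in>S. G x * G y * cosine \<eta> (d x y)) = \<mu> * (G x)\<^sup>2" if x: "x \<in> S" for x
  proof -
    have "(\<Sum>y\<in>S. G x * G y * cosine \<eta> (d x y))
        = (\<Sum>y\<in>S. G x * (?c2 * G y + (if x = y then (1 - ?c2) * G y else 0)
            + (?c1 - ?c2) * (if E x y then G y else 0)))"
      using cos[OF x] Q.E_irrefl[OF x] by (intro sum.cong refl) (auto simp: algebra_simps)
    also have "\<dots> = G x * (?c2 * (\<Sum>y\<in>S. G y) + (\<Sum>y\<in>S. if x = y then (1 - ?c2) * G y else 0)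
        + (?c1 - ?c2) * (\<Sum>y\<in>S. if E x y then G y else 0))"
      by (simp only: sum.distrib flip: sum_distrib_left)
    also have "(\<Sum>y\<in>S. if x = y then (1 - ?c2) * G y else 0) = (1 - ?c2) * G x"
      using x Q.finite_V by (subst sum.delta') auto
    also have "(\<Sum>y\<in>S. if E x y then G y else 0) = - (s\<^sup>2 + 1) * G x"
      using G[OF x] Q.finite_V by (simp add: sum.inter_filter)
    finally show ?thesis
      unfolding sum_G \<mu>_def by (simp add: algebra_simps power2_eq_square del: cosine.simps)
  qed
  have "0 \<le> (\<Sum>x\<in>S. \<Sum>y\<in>S. G x * G y * cosine \<eta> (d x y))"
    by (rule gram_nonneg[OF \<eta> Q.finite_V])
  also have "\<dots> = \<mu> * (\<Sum>x\<in>S. (G x)\<^sup>2)"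
    by (simp add: row sum_distrib_left)
  finally have nonneg: "\<mu> * (\<Sum>x\<in>S. (G x)\<^sup>2) \<ge> 0" .
  have "(G p)\<^sup>2 \<le> (\<Sum>x\<in>S. (G x)\<^sup>2)"
    using p Q.finite_V by (intro member_le_sum) auto
  then have "(\<Sum>x\<in>S. (G x)\<^sup>2) > 0" using p by (simp add: G_def)
  with nonneg have "\<mu> \<ge> 0" by (simp add: zero_le_mult_iff)
  have c1: "k * ?c1 = \<eta>" using k_pos by simp
  have "1 + (s - 1) * ?c1 + (k - s) * ?c2 = \<eta> * ?c1"
    using cosine_rec[of 1 \<eta>] D_ge_2 a_1 b_1 c_1[OF D_pos] by (simp add: numeral_2_eq_2)
  then have "k * ((k - s) * ?c2) = k * (\<eta> * ?c1 - 1 - (s - 1) * ?c1)" by simp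
  also have "\<dots> = \<eta> * (k * ?c1) - k - (s - 1) * (k * ?c1)" by (simp only: algebra_simps)
  finally have c2: "k * ((k - s) * ?c2) = \<eta> * \<eta> - k - (s - 1) * \<eta>" unfolding c1 .
  \<comment> \<open>By the recurrence the left side is a quadratic in \<open>\<eta>\<close>. One
    root is \<open>k\<close>, where all cosines equal 1; the other is \<open>\<rho>\<close>.\<close>
  have "k * (k - s) * \<mu> = k * (k - s) + s\<^sup>2 * (k * ((k - s) * ?c2)) - (s\<^sup>2 + 1) * (k - s) * (k * ?c1)"
    unfolding \<mu>_def by (simp only: algebra_simps)
  also have "\<dots> = (\<eta> - k) * (s\<^sup>2 * \<eta> - (k - s * (s + 1)))"
    unfolding c1 c2 by (simp add: algebra_simps power2_eq_square)
  also have "k - s * (s + 1) = s\<^sup>2 * \<rho>"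
    unfolding \<rho>_def using s_gt_1 by simp
  finally have "s\<^sup>2 * ((\<eta> - k) * (\<eta> - \<rho>)) = k * (k - s) * \<mu>"
    by (simp add: algebra_simps)
  also have "\<dots> \<ge> 0" using k_pos b_1(2) \<open>\<mu> \<ge> 0\<close> by simp
  finally show ?thesis using s_gt_1 by (simp add: zero_le_mult_iff)
qed

end

text \<open>The unit vectors of two adjacent vertices have inner product
  \<open>\<eta> / b 0\<close>, which is at most 1 by Cauchy-Schwarz.\<close>

lemma (in finite_drg) eigenvalue_le_degree:
  assumes "radial_eigen \<eta> (cosine \<eta>)"
  shows "\<eta> \<le> b 0"
proof -
  obtain x y where xy: "d x y = 1" using ex_d_eq[of 1] D_pos by auto
  have "norm (rep \<eta> z) = 1" for z
    using inner_rep[OF assms, of z z] by (simp add: norm_eq_1)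
  then have "rep \<eta> x \<bullet> rep \<eta> y \<le> 1"
    using norm_cauchy_schwarz[of "rep \<eta> x" "rep \<eta> y"] by simp
  then have "\<eta> / b 0 \<le> 1" using inner_rep[OF assms, of x y] xy by simp
  then show ?thesis using b_pos[of 0] D_pos by (simp add: divide_le_eq_1)
qed

theorem theorem3p3:
  fixes E :: "'a::finite \<Rightarrow> 'a \<Rightarrow> bool"
    and D :: nat and b c :: "nat \<Rightarrow> nat" and \<theta> :: "nat \<Rightarrow> real"
  assumes drg: "distance_regular (UNIV :: 'a set) E D b c"
    and k3: "b 0 \<ge> 3"
    and D2: "D \<ge> 2"
    and a1: "dr_a b c 1 \<noteq> 0"
    and ev_dec: "\<And>i j. i < j \<Longrightarrow> j \<le> D \<Longrightarrow> \<theta> i > \<theta> j"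
    and ev_all: "{r. is_eigenvalue (adj_matrix E) r} = \<theta> ` {0..D}"
    and thetaD: "\<theta> D = - real (b 0) / (of_int (dr_a b c 1) + 1)"
    and c2: "int (c 2) = (dr_a b c 1 + 1)^2 + 1"
    and GQ: "has_induced_GQ E (nat (dr_a b c 1 + 1)) (c 2 - 1)"
  shows "\<theta> 1 = (real (b 0) - (of_int (dr_a b c 1) + 1) * (of_int (dr_a b c 1) + 2))
                 / (of_int (dr_a b c 1) + 1)^2
     \<and> light_tail_with (adj_matrix E) (eigenproj (adj_matrix E) (\<theta> 0))
         (eigenproj (adj_matrix E) (\<theta> D)) (eigenproj (adj_matrix E) (\<theta> 1))"
proof -
  interpret finite_drg E D b c
    using drg D2 by unfold_locales auto
  define n where "n = nat (dr_a b c 1 + 1)"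
  have a_1: "a 1 = of_int (dr_a b c 1)" by (simp add: dr_a_def)
  obtain x y where "E x y" using ex_d_eq[of 1] D_pos d_eq_1 by auto
  \<comment> \<open>As a count of common neighbours \<open>a 1\<close> is nonnegative, so the
    nonzero integer is at least 1 and \<open>n\<close> at least 2.\<close>
  then have "a 1 \<ge> 0" using card_common_nbrs_1[of x y] by simp
  then have "dr_a b c 1 > 0" using a_1 a1 by linarith
  then have n: "dr_a b c 1 + 1 = int n" "n > 1" by (simp_all add: n_def)
  have rn: "of_int (dr_a b c 1) + 1 = real n" using n(1) by linarith
  have "int (c 2) = int (n\<^sup>2 + 1)" using c2 n(1) by simp
  then have cn: "c 2 = n\<^sup>2 + 1" by (simp only: of_nat_eq_iff)
  have thD: "\<theta> D = - (b 0 / real n)" using thetaD rn by simp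
  have ev: "radial_eigen r (cosine r) \<longleftrightarrow> (\<exists>j\<le>D. r = \<theta> j)" for r
    using ev_all is_eigenvalue_iff[of r] by (auto simp: set_eq_iff image_iff)
  interpret tight_drg E D b c "real n"
  proof unfold_locales
    show "D \<ge> 2" by (rule D2)
    show "a 1 = real n - 1" using a_1 rn by linarith
    show "real n > 1" using n(2) by simp
    show "real (c 2) = (real n)\<^sup>2 + 1" using cn by simp
    show "radial_eigen (- (b 0 / real n)) (cosine (- (b 0 / real n)))"
      using ev[of "\<theta> D"] thD by auto
  qed
  obtain S where S: "is_GQ S E n (n\<^sup>2)"
    using GQ cn unfolding has_induced_GQ_def n_def[symmetric] by auto
  have th0: "\<theta> 0 = k"
  proof -
    have "radial_eigen k (cosine k)"
      by (rule radial_eigen_cosineI[OF radial_eigen_degree]) simp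
    then obtain j where j: "j \<le> D" "k = \<theta> j" using ev by blast
    have "\<theta> 0 \<le> k" using ev[of "\<theta> 0"] by (intro eigenvalue_le_degree) auto
    then have "j = 0" using ev_dec[of 0 j] j by (cases "j = 0") auto
    then show ?thesis using j by simp
  qed
  have th1: "\<theta> 1 = \<rho>"
  proof -
    \<comment> \<open>Some \<open>\<theta> j\<close> equals \<open>\<rho>\<close>. An index
      \<open>j > 1\<close> would put \<open>\<theta> 1\<close> strictly between
      \<open>\<rho>\<close> and \<open>k\<close>, which the quadrangle excludes.\<close>
    obtain j where j: "j \<le> D" "\<rho> = \<theta> j" using radial_eigen_cosine_\<rho> ev by blast
    have "j \<noteq> 0" using \<rho>_shift(1) th0 j(2) by (metis less_irrefl)
    moreover have "\<not> j > 1"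
    proof
      assume "j > 1"
      then have "\<theta> 1 > \<rho>" using ev_dec[of 1 j] j by simp
      moreover have "\<theta> 1 < k" using ev_dec[of 0 1] D2 th0 by simp
      ultimately have "(\<theta> 1 - k) * (\<theta> 1 - \<rho>) < 0" by (simp add: mult_neg_pos)
      moreover have "radial_eigen (\<theta> 1) (cosine (\<theta> 1))"
        using ev[of "\<theta> 1"] D_pos by blast
      ultimately show False using GQ_eigenvalue_bound[OF S refl, of "\<theta> 1"] by simp
    qed
    ultimately show ?thesis using j by (metis less_one linorder_neqE_nat)
  qed
  have r2: "of_int (dr_a b c 1) + 2 = real n + 1" using rn by linarith
  show ?thesis
    using light_tail unfolding rn r2 th0 th1 thD by (simp add: \<rho>_def)
qed

end
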